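(* Let $(\Theta,\mathcal{T})$ be a measurable space, $\pi\in\mathcal{P}(\Theta)$, $\eta>0$, and let $(\ell_t)_{t\in\mathbb{N}}$ be a sequence of $\mathcal{T}$-measurable functions $\ell_t:\Theta\to\mathbb{R}_+$. Define, for each $t\ge 1$, $$\rho^t=\operatorname*{argmin}_{\rho\in\mathcal{P}(\Theta)}\left\{\sum_{s=1}^{t-1}\mathbb{E}_{\theta\sim\rho}[\ell_s(\theta)]+\frac{\chi^2(\rho\|\pi)}{\eta}\right\}.$$ Assume that there is $L>0$ such that for any $t\in\mathbb{N}$, $$\int\ell_t(\theta)^2\,\pi(d\theta)\le L^2.$$ Then, for every $T\ge 1$, $$\sum_{t=1}^T\mathbb{E}_{\theta\sim\rho^t}[\ell_t(\theta)]\le\inf_{\rho\in\mathcal{P}(\Theta)}\left\{\sum_{t=1}^T\mathbb{E}_{\theta\sim\rho}[\ell_t(\theta)]+\frac{\eta L^2T}{2}+\frac{\chi^2(\rho\|\pi)}{\eta}\right\}.$$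
   Context: $\mathcal{P}(\Theta)$ is the set of all probability distributions on $(\Theta,\mathcal{T})$. The $\chi^2$-divergence is the $\phi$-divergence with $\phi(x)=x^2-1$: $\chi^2(\rho\|\pi)=\int\left[\left(\frac{d\rho}{d\pi}(\theta)\right)^2-1\right]\pi(d\theta)$ if $\rho\ll\pi$, and $+\infty$ otherwise. *)

theory Defs
  imports "HOL-Probability.Probability"
begin

text \<open>
  The set of probability distributions on a measurable space is rendered by the library as
  \<^term>\<open>space (prob_algebra M)\<close>; only \<^term>\<open>space M\<close> and \<^term>\<open>sets M\<close> matter.

  The losses are nonnegative but need not be integrable with respect to every probability
  measure, so expectations of nonnegative functions take values in \<open>[0, \<infinity>]\<close>.
\<close>

definition expect :: "'a measure \<Rightarrow> ('a \<Rightarrow> real) \<Rightarrow> ereal" where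
  "expect \<rho> f = enn2ereal (\<integral>\<^sup>+ \<theta>. ennreal (f \<theta>) \<partial>\<rho>)"

text \<open>
  For \<open>\<pi>\<close> a probability measure the integrand below is bounded from below by \<open>-1\<close>, so its
  integral always exists in \<open>(-\<infinity>, \<infinity>]\<close> and is \<open>\<infinity>\<close> precisely when the integrand is not integrable.
  The library's argument order is reversed: \<^term>\<open>absolutely_continuous \<pi> \<rho>\<close> says that \<open>\<rho>\<close>
  is absolutely continuous with respect to \<open>\<pi>\<close>. The density is finite \<open>\<pi>\<close>-almost everywhere,
  so \<^term>\<open>enn2real\<close> loses nothing.
\<close>

definition chi2_divergence :: "'a measure \<Rightarrow> 'a measure \<Rightarrow> ereal" where
  "chi2_divergence \<rho> \<pi> =
    (if absolutely_continuous \<pi> \<rho> \<and>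
        integrable \<pi> (\<lambda>\<theta>. (enn2real (RN_deriv \<pi> \<rho> \<theta>))\<^sup>2 - 1)
     then ereal (\<integral>\<theta>. ((enn2real (RN_deriv \<pi> \<rho> \<theta>))\<^sup>2 - 1) \<partial>\<pi>)
     else \<infinity>)"

end

theory Submission imports Defs
begin

text \<open>
  Follow-the-regularised-leader: on densities the objective is
  \<open>F q = \<integral>q g d\<pi> + (\<integral>q\<^sup>2 d\<pi> - 1) / \<eta>\<close> with \<open>g\<close> the cumulative loss, a quadratic whose minimiser is
  the truncation \<open>p = \<eta>/2 (\<lambda> - g)\<^sub>+\<close>, the level \<open>\<lambda>\<close> being fixed by \<open>\<integral>p d\<pi> = 1\<close>. Since
  \<open>g + 2p/\<eta> = max g \<lambda>\<close>, one gets \<open>F q \<ge> F p + \<parallel>q - p\<parallel>\<^sup>2 / \<eta>\<close> for every density \<open>q\<close>, so the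
  minimiser is unique. Adding the next loss \<open>f\<close> and using
  \<open>\<parallel>q - p\<parallel>\<^sup>2/\<eta> + \<integral>f (q - p) d\<pi> \<ge> - \<eta>/4 \<parallel>f\<parallel>\<^sup>2\<close>, the minimal objective grows in each round by at
  least \<open>\<integral>f p d\<pi> - \<eta> L\<^sup>2/4\<close>; these increments telescope.
\<close>

section \<open>Square-integrable functions and expectations\<close>

definition square_integrable :: "'a measure \<Rightarrow> ('a \<Rightarrow> real) \<Rightarrow> bool" where
  "square_integrable M f \<longleftrightarrow> f \<in> borel_measurable M \<and> integrable M (\<lambda>x. (f x)\<^sup>2)"

text \<open>Nonnegativity is required at every point, not just almost everywhere, so that passing
  from \<open>p x\<close> to \<open>ennreal (p x)\<close> never truncates.\<close>

definition square_integrable_density :: "'a measure \<Rightarrow> ('a \<Rightarrow> real) \<Rightarrow> bool" where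
  "square_integrable_density M p \<longleftrightarrow>
    square_integrable M p \<and> (\<forall>x. 0 \<le> p x) \<and> (\<integral>x. p x \<partial>M) = 1"

lemma square_integrable_mult:
  assumes "square_integrable M f" "square_integrable M g"
  shows "integrable M (\<lambda>x. f x * g x)"
proof (rule Bochner_Integration.integrable_bound)
  show "integrable M (\<lambda>x. (f x)\<^sup>2 + (g x)\<^sup>2)"
    using assms by (auto simp: square_integrable_def)
  show "(\<lambda>x. f x * g x) \<in> borel_measurable M"
    using assms by (auto simp: square_integrable_def)
  have "\<bar>a * b\<bar> \<le> a\<^sup>2 + b\<^sup>2" for a b :: real
  proof -
    have "0 \<le> (\<bar>a\<bar> - \<bar>b\<bar>)\<^sup>2 + a\<^sup>2 + b\<^sup>2" by simp
    then show ?thesis by (simp add: power2_diff abs_mult)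
  qed
  then show "AE x in M. norm (f x * g x) \<le> norm ((f x)\<^sup>2 + (g x)\<^sup>2)"
    by simp
qed

lemma square_integrable_add:
  assumes "square_integrable M f" "square_integrable M g"
  shows "square_integrable M (\<lambda>x. f x + g x)"
  using assms square_integrable_mult[OF assms]
  by (auto simp: square_integrable_def power2_sum mult.assoc)

lemma square_integrable_cmult:
  "square_integrable M f \<Longrightarrow> square_integrable M (\<lambda>x. c * f x)"
  by (auto simp: square_integrable_def power_mult_distrib)

lemma square_integrable_diff:
  assumes "square_integrable M f" "square_integrable M g"
  shows "square_integrable M (\<lambda>x. f x - g x)"
  using square_integrable_add[OF assms(1) square_integrable_cmult[OF assms(2), of "-1"]] by simp

lemma square_integrable_sum:
  assumes "\<And>i. i \<in> I \<Longrightarrow> square_integrable M (f i)"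
  shows "square_integrable M (\<lambda>x. \<Sum>i\<in>I. f i x)"
  using assms
proof (induction I rule: infinite_finite_induct)
  case (insert i I)
  then show ?case using square_integrable_add[of M "f i"] by simp
qed (simp_all add: square_integrable_def)

text \<open>Bridge from a second-moment bound in \<open>[0, \<infinity>]\<close>, the form in which
  the losses are controlled, to the Bochner integrals of the real-valued estimates.\<close>

lemma square_integrable_if_nn_integral_le:
  assumes "f \<in> borel_measurable M" "(\<integral>\<^sup>+x. ennreal ((f x)\<^sup>2) \<partial>M) \<le> ennreal c" "0 \<le> c"
  shows "square_integrable M f" "(\<integral>x. (f x)\<^sup>2 \<partial>M) \<le> c"
proof -
  have "(\<integral>\<^sup>+x. ennreal ((f x)\<^sup>2) \<partial>M) < \<infinity>"
    using assms(2) by (rule order.strict_trans1) simp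
  then have int: "integrable M (\<lambda>x. (f x)\<^sup>2)"
    using assms(1) by (intro integrableI_nonneg) auto
  then show "square_integrable M f"
    using assms(1) by (auto simp: square_integrable_def)
  have "ennreal (\<integral>x. (f x)\<^sup>2 \<partial>M) \<le> ennreal c"
    using assms(2) by (subst nn_integral_eq_integral[symmetric, OF int]) auto
  then show "(\<integral>x. (f x)\<^sup>2 \<partial>M) \<le> c"
    using assms(3) by simp
qed

text \<open>A product of two square-integrable functions is integrable, so this expectation is
  finite and real arithmetic becomes available.\<close>

lemma expect_density:
  assumes "square_integrable M p" "\<And>x. 0 \<le> p x"
    and "square_integrable M g" "\<And>x. x \<in> space M \<Longrightarrow> 0 \<le> g x"
  shows "expect (density M (\<lambda>x. ennreal (p x))) g = ereal (\<integral>x. p x * g x \<partial>M)"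
proof -
  have "(\<integral>\<^sup>+x. ennreal (g x) \<partial>density M (\<lambda>x. ennreal (p x)))
      = (\<integral>\<^sup>+x. ennreal (p x) * ennreal (g x) \<partial>M)"
    using assms by (intro nn_integral_density) (auto simp: square_integrable_def)
  also have "\<dots> = (\<integral>\<^sup>+x. ennreal (p x * g x) \<partial>M)"
    using assms by (intro nn_integral_cong) (simp add: ennreal_mult)
  also have "\<dots> = ennreal (\<integral>x. p x * g x \<partial>M)"
    using assms by (intro nn_integral_eq_integral square_integrable_mult) auto
  finally show ?thesis
    using assms by (simp add: expect_def integral_nonneg_AE)
qed

text \<open>Merges the past losses into one cumulative loss. By nonnegativity this also holds when
  some expectations are infinite.\<close>

lemma sum_expect:
  assumes "\<And>i. i \<in> I \<Longrightarrow> f i \<in> borel_measurable M"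
    and "\<And>i x. i \<in> I \<Longrightarrow> x \<in> space M \<Longrightarrow> 0 \<le> f i x"
  shows "(\<Sum>i\<in>I. expect M (f i)) = expect M (\<lambda>x. \<Sum>i\<in>I. f i x)"
proof -
  have sum_enn2ereal: "(\<Sum>i\<in>I. enn2ereal (u i)) = enn2ereal (\<Sum>i\<in>I. u i)" for u
    by (induction I rule: infinite_finite_induct) (simp_all add: plus_ennreal.rep_eq zero_ennreal.rep_eq)
  have "(\<Sum>i\<in>I. \<integral>\<^sup>+x. ennreal (f i x) \<partial>M) = (\<integral>\<^sup>+x. (\<Sum>i\<in>I. ennreal (f i x)) \<partial>M)"
    using assms(1) by (intro nn_integral_sum[symmetric]) auto
  also have "\<dots> = (\<integral>\<^sup>+x. ennreal (\<Sum>i\<in>I. f i x) \<partial>M)"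
    using assms(2) by (intro nn_integral_cong sum_ennreal) auto
  finally show ?thesis
    by (simp add: expect_def sum_enn2ereal)
qed

section \<open>Probability measures of finite divergence and their densities\<close>

context prob_space
begin

lemma square_integrable_integrable:
  assumes "square_integrable M f"
  shows "integrable M f"
  using square_integrable_mult[OF assms, of "\<lambda>_. 1"] by (auto simp: square_integrable_def)

lemma density_in_prob_algebra:
  assumes "square_integrable_density M p"
  shows "density M (\<lambda>x. ennreal (p x)) \<in> space (prob_algebra M)"
proof -
  have p: "square_integrable M p" "\<And>x. 0 \<le> p x" "(\<integral>x. p x \<partial>M) = 1"
    using assms by (auto simp: square_integrable_density_def)
  then have meas: "p \<in> borel_measurable M"
    by (auto simp: square_integrable_def)
  have "(\<integral>\<^sup>+x. ennreal (p x) \<partial>M) = 1"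
    using p square_integrable_integrable[OF p(1)] by (subst nn_integral_eq_integral) auto
  then have "prob_space (density M (\<lambda>x. ennreal (p x)))"
    using meas by (intro prob_spaceI) (auto simp: emeasure_density cong: nn_integral_cong)
  then show ?thesis by (simp add: space_prob_algebra)
qed

text \<open>Radon-Nikodym derivatives are unique almost everywhere, so \<open>p\<close> may replace
  the derivative under the integral; the constant 1 integrates to 1.\<close>

lemma chi2_divergence_density:
  assumes "square_integrable_density M p"
  shows "chi2_divergence (density M (\<lambda>x. ennreal (p x))) M = ereal ((\<integral>x. (p x)\<^sup>2 \<partial>M) - 1)"
proof -
  let ?D = "density M (\<lambda>x. ennreal (p x))"
  have p: "p \<in> borel_measurable M" "integrable M (\<lambda>x. (p x)\<^sup>2)" "\<And>x. 0 \<le> p x"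
    using assms by (auto simp: square_integrable_density_def square_integrable_def)
  have ac: "absolutely_continuous M ?D"
    using p(1) by (intro absolutely_continuousI_density) auto
  have "AE x in M. ennreal (p x) = RN_deriv M ?D x"
    using p(1) by (intro RN_deriv_unique) auto
  then have eq: "AE x in M. (enn2real (RN_deriv M ?D x))\<^sup>2 - 1 = (p x)\<^sup>2 - 1"
    by eventually_elim (metis enn2real_ennreal p(3))
  have "integrable M (\<lambda>x. (enn2real (RN_deriv M ?D x))\<^sup>2 - 1)"
    using p(1,2) by (subst integrable_cong_AE[OF _ _ eq]) auto
  moreover have "(\<integral>x. (enn2real (RN_deriv M ?D x))\<^sup>2 - 1 \<partial>M) = (\<integral>x. (p x)\<^sup>2 - 1 \<partial>M)"
    using p(1) eq by (intro integral_cong_AE) auto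
  ultimately show ?thesis
    using ac p(2) by (simp add: chi2_divergence_def prob_space)
qed

lemma expect_plus_chi2_density:
  fixes g :: "'a \<Rightarrow> real"
  assumes p: "square_integrable_density M p"
    and g: "square_integrable M g" "\<And>x. x \<in> space M \<Longrightarrow> 0 \<le> g x" and "0 < \<eta>"
  shows "expect (density M (\<lambda>x. ennreal (p x))) g
      + chi2_divergence (density M (\<lambda>x. ennreal (p x))) M / ereal \<eta>
    = ereal ((\<integral>x. p x * g x \<partial>M) + ((\<integral>x. (p x)\<^sup>2 \<partial>M) - 1) / \<eta>)"
proof -
  have "expect (density M (\<lambda>x. ennreal (p x))) g = ereal (\<integral>x. p x * g x \<partial>M)"
    using p g by (intro expect_density) (auto simp: square_integrable_density_def)
  then show ?thesis
    using \<open>0 < \<eta>\<close> by (simp add: chi2_divergence_density[OF p])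
qed

text \<open>Finite divergence supplies absolute continuity and a square-integrable derivative. With
  the preceding lemmas, this reduces minimisation over measures to minimisation over
  square-integrable densities.\<close>

lemma density_of_finite_chi2_divergence:
  assumes "\<nu> \<in> space (prob_algebra M)" "chi2_divergence \<nu> M \<noteq> \<infinity>"
  obtains q where "square_integrable_density M q" "\<nu> = density M (\<lambda>x. ennreal (q x))"
proof -
  interpret \<nu>: prob_space \<nu> using assms(1) by (simp add: space_prob_algebra)
  have sets: "sets \<nu> = sets M" using assms(1) by (simp add: space_prob_algebra)
  define q where "q = (\<lambda>x. enn2real (RN_deriv M \<nu> x))"
  have ac: "absolutely_continuous M \<nu>" and "integrable M (\<lambda>x. (q x)\<^sup>2 - 1)"
    using assms(2) by (auto simp: chi2_divergence_def q_def split: if_splits)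
  from this(2) have "integrable M (\<lambda>x. ((q x)\<^sup>2 - 1) + 1)"
    by (intro Bochner_Integration.integrable_add) auto
  then have q: "square_integrable M q"
    by (simp add: square_integrable_def q_def)
  \<comment> \<open>\<open>enn2real\<close> sends \<infinity> to 0, so finiteness almost everywhere
    is what lets \<open>q\<close> recover the derivative.\<close>
  have fin: "AE x in M. RN_deriv M \<nu> x \<noteq> \<infinity>"
    using ac sets by (intro RN_deriv_finite) (auto intro: \<nu>.sigma_finite_measure_axioms)
  have "\<nu> = density M (RN_deriv M \<nu>)"
    using ac sets by (simp add: density_RN_deriv)
  also have "\<dots> = density M (\<lambda>x. ennreal (q x))"
    using fin by (intro density_cong) (auto simp: q_def less_top)
  finally have \<nu>: "\<nu> = density M (\<lambda>x. ennreal (q x))" .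
  have "ennreal (\<integral>x. q x \<partial>M) = (\<integral>\<^sup>+x. ennreal (q x) \<partial>M)"
    using square_integrable_integrable[OF q]
    by (intro nn_integral_eq_integral[symmetric]) (auto simp: q_def)
  also have "\<dots> = emeasure \<nu> (space \<nu>)"
    using q by (subst (1 2) \<nu>) (auto simp: emeasure_density square_integrable_def cong: nn_integral_cong)
  finally have "(\<integral>x. q x \<partial>M) = 1"
    by (simp add: \<nu>.emeasure_space_1)
  then have "square_integrable_density M q"
    using q by (simp add: square_integrable_density_def q_def)
  then show thesis using \<nu> that by blast
qed

text \<open>A density has mean 1, so \<open>\<integral>q\<^sup>2 - 1\<close> is its
  variance.\<close>

lemma integral_square_density_ge_1:
  assumes "square_integrable_density M q"
  shows "1 \<le> (\<integral>x. (q x)\<^sup>2 \<partial>M)"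
proof -
  have q: "integrable M q" "integrable M (\<lambda>x. (q x)\<^sup>2)" "(\<integral>x. q x \<partial>M) = 1"
    using assms square_integrable_integrable[of q]
    by (auto simp: square_integrable_density_def) (auto simp: square_integrable_def)
  have "0 \<le> (\<integral>x. (q x - 1)\<^sup>2 \<partial>M)" by simp
  also have "\<dots> = (\<integral>x. (q x)\<^sup>2 + 1 - 2 * q x \<partial>M)"
    by (simp add: power2_diff)
  also have "\<dots> = (\<integral>x. (q x)\<^sup>2 \<partial>M) - 1"
    using q by (simp add: prob_space)
  finally show ?thesis by simp
qed

lemma chi2_divergence_nonneg:
  assumes "\<nu> \<in> space (prob_algebra M)"
  shows "0 \<le> chi2_divergence \<nu> M"
proof (cases "chi2_divergence \<nu> M = \<infinity>")
  case False
  then obtain q where "square_integrable_density M q" "\<nu> = density M (\<lambda>x. ennreal (q x))"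
    using density_of_finite_chi2_divergence assms by blast
  then show ?thesis
    by (simp add: chi2_divergence_density integral_square_density_ge_1)
qed simp

section \<open>The minimiser of the regularised objective\<close>

text \<open>Intermediate value theorem: the truncated integral is 1-Lipschitz in the level, vanishes
  at level 0 because \<open>g\<close> is nonnegative, and reaches \<open>c\<close> by level
  \<open>c + \<integral>g\<close>.\<close>

lemma exists_truncation_level:
  fixes g :: "'a \<Rightarrow> real"
  assumes g: "integrable M g" "\<And>x. x \<in> space M \<Longrightarrow> 0 \<le> g x" and "0 \<le> c"
  obtains u where "0 \<le> u" "(\<integral>x. max 0 (u - g x) \<partial>M) = c"
proof -
  define h where "h = (\<lambda>u. \<integral>x. max 0 (u - g x) \<partial>M)"
  have int: "integrable M (\<lambda>x. max 0 (u - g x))" for u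
    using g(1) by (intro integrable_max) auto
  have "dist (h u) (h v) \<le> 1 * dist u v" for u v
  proof -
    have "dist (h u) (h v) = \<bar>\<integral>x. max 0 (u - g x) - max 0 (v - g x) \<partial>M\<bar>"
      using int by (simp add: h_def dist_real_def)
    also have "\<dots> \<le> (\<integral>x. \<bar>max 0 (u - g x) - max 0 (v - g x)\<bar> \<partial>M)"
      by (rule integral_abs_bound)
    also have "\<dots> \<le> (\<integral>x. \<bar>u - v\<bar> \<partial>M)"
      using int by (intro integral_mono) auto
    finally show ?thesis by (simp add: prob_space dist_real_def)
  qed
  then have "1-lipschitz_on UNIV h"
    by (intro lipschitz_onI) auto
  then have "continuous_on UNIV h"
    by (rule lipschitz_on_continuous_on)
  then have cont: "continuous_on {0..c + (\<integral>x. g x \<partial>M)} h"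
    by (rule continuous_on_subset) simp
  have g0: "0 \<le> (\<integral>x. g x \<partial>M)" using g by (intro integral_nonneg_AE) auto
  have "h 0 = (\<integral>x. 0 \<partial>M)"
    unfolding h_def using g(2) by (intro Bochner_Integration.integral_cong) (auto simp: max_absorb1)
  then have h0: "h 0 \<le> c" using assms(3) by simp
  \<comment> \<open>At this level the integral without truncation is exactly \<open>c\<close>, and
    truncating at 0 can only increase it.\<close>
  have "c = (\<integral>x. (c + (\<integral>x. g x \<partial>M)) - g x \<partial>M)"
    using g(1) by (simp add: prob_space)
  also have "\<dots> \<le> h (c + (\<integral>x. g x \<partial>M))"
    unfolding h_def using g(1) int by (intro integral_mono) auto
  finally have "c \<le> h (c + (\<integral>x. g x \<partial>M))" .
  with IVT'[of h 0 c "c + (\<integral>x. g x \<partial>M)"] h0 cont g0 assms(3)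
  obtain u where "0 \<le> u" "h u = c" by auto
  then show thesis using that by (simp add: h_def)
qed

text \<open>The level \<open>u\<close> acts as the Lagrange multiplier of the mass constraint. The
  term \<open>(q - p)\<^sup>2 / \<eta>\<close> is the exact second-order remainder of the quadratic,
  so only a first-order term needs a sign.\<close>

lemma exists_strong_minimiser:
  fixes g :: "'a \<Rightarrow> real"
  assumes g: "square_integrable M g" "\<And>x. x \<in> space M \<Longrightarrow> 0 \<le> g x" and "0 < \<eta>"
  obtains p where "square_integrable_density M p"
    "\<And>q. square_integrable_density M q \<Longrightarrow>
      (\<integral>x. p x * g x \<partial>M) + ((\<integral>x. (p x)\<^sup>2 \<partial>M) - 1) / \<eta> + (\<integral>x. (q x - p x)\<^sup>2 \<partial>M) / \<eta>
      \<le> (\<integral>x. q x * g x \<partial>M) + ((\<integral>x. (q x)\<^sup>2 \<partial>M) - 1) / \<eta>"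
proof -
  \<comment> \<open>The value \<open>2 / \<eta>\<close> cancels the factor \<open>\<eta> / 2\<close>
    in \<open>p\<close>, giving \<open>p\<close> mass 1.\<close>
  obtain u where "0 \<le> u" and u: "(\<integral>x. max 0 (u - g x) \<partial>M) = 2 / \<eta>"
    using exists_truncation_level[of g "2 / \<eta>"] g square_integrable_integrable[OF g(1)] \<open>0 < \<eta>\<close>
    by auto
  define p where "p = (\<lambda>x. \<eta> / 2 * max 0 (u - g x))"
  have "square_integrable M (\<lambda>x. max 0 (u - g x))"
    unfolding square_integrable_def
  proof
    show meas: "(\<lambda>x. max 0 (u - g x)) \<in> borel_measurable M"
      using g(1) by (auto simp: square_integrable_def)
    have "(max 0 (u - g x))\<^sup>2 \<le> u\<^sup>2" if "x \<in> space M" for x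
      using g(2)[OF that] \<open>0 \<le> u\<close> by (intro power_mono) auto
    then show "integrable M (\<lambda>x. (max 0 (u - g x))\<^sup>2)"
      using meas by (intro integrable_const_bound[where B = "u\<^sup>2"]) auto
  qed
  then have "square_integrable M p"
    unfolding p_def by (rule square_integrable_cmult)
  moreover have "(\<integral>x. p x \<partial>M) = 1"
    using u \<open>0 < \<eta>\<close> by (simp add: p_def)
  ultimately have p: "square_integrable_density M p"
    using \<open>0 < \<eta>\<close> by (simp add: square_integrable_density_def p_def)
  show thesis
  proof (rule that[OF p])
    fix q assume q: "square_integrable_density M q"
    have sq: "square_integrable M q" "\<And>x. 0 \<le> q x" "(\<integral>x. q x \<partial>M) = 1"
      and sp: "square_integrable M p" "\<And>x. 0 \<le> p x" "(\<integral>x. p x \<partial>M) = 1"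
      using p q by (auto simp: square_integrable_density_def)
    note int = square_integrable_mult[OF sq(1) g(1)] square_integrable_mult[OF sp(1) g(1)]
      square_integrable_integrable[OF sq(1)] square_integrable_integrable[OF sp(1)]
    have int2: "integrable M (\<lambda>x. (q x)\<^sup>2)" "integrable M (\<lambda>x. (p x)\<^sup>2)"
      "integrable M (\<lambda>x. (q x - p x)\<^sup>2)"
      using sq(1) sp(1) square_integrable_diff[OF sq(1) sp(1)] by (auto simp: square_integrable_def)
    \<comment> \<open>Subtracting \<open>u * (q x - p x)\<close> is free after integration, since
      \<open>p\<close> and \<open>q\<close> have equal mass.\<close>
    have pointwise: "0 \<le> (q x * g x + (q x)\<^sup>2 / \<eta>) - (p x * g x + (p x)\<^sup>2 / \<eta>)
        - (q x - p x)\<^sup>2 / \<eta> - u * (q x - p x)" for x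
    proof -
      have "(q x * g x + (q x)\<^sup>2 / \<eta>) - (p x * g x + (p x)\<^sup>2 / \<eta>)
        - (q x - p x)\<^sup>2 / \<eta> - u * (q x - p x) = (q x - p x) * (g x + 2 * p x / \<eta> - u)"
        using \<open>0 < \<eta>\<close> by (simp add: field_simps power2_eq_square)
      also have "g x + 2 * p x / \<eta> - u = max 0 (g x - u)"
        using \<open>0 < \<eta>\<close> by (simp add: p_def max_def)
      \<comment> \<open>Complementary slackness: \<open>p\<close> vanishes wherever \<open>g\<close>
        exceeds \<open>u\<close>.\<close>
      also have "(q x - p x) * max 0 (g x - u) = q x * max 0 (g x - u)"
        by (simp add: p_def max_def)
      finally show ?thesis using sq(2) by simp
    qed
    have "0 \<le> (\<integral>x. (q x * g x + (q x)\<^sup>2 / \<eta>) - (p x * g x + (p x)\<^sup>2 / \<eta>)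
        - (q x - p x)\<^sup>2 / \<eta> - u * (q x - p x) \<partial>M)"
      using pointwise by (intro integral_nonneg_AE) auto
    also have "\<dots> = ((\<integral>x. q x * g x \<partial>M) + (\<integral>x. (q x)\<^sup>2 \<partial>M) / \<eta>)
        - ((\<integral>x. p x * g x \<partial>M) + (\<integral>x. (p x)\<^sup>2 \<partial>M) / \<eta>) - (\<integral>x. (q x - p x)\<^sup>2 \<partial>M) / \<eta>"
      using int int2 sq(3) sp(3) by simp
    finally show "(\<integral>x. p x * g x \<partial>M) + ((\<integral>x. (p x)\<^sup>2 \<partial>M) - 1) / \<eta> + (\<integral>x. (q x - p x)\<^sup>2 \<partial>M) / \<eta>
      \<le> (\<integral>x. q x * g x \<partial>M) + ((\<integral>x. (q x)\<^sup>2 \<partial>M) - 1) / \<eta>"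
      by (simp add: diff_divide_distrib)
  qed
qed

text \<open>\<open>arg_min\<close> is a choice operator, so it says something only once a minimiser
  exists; the quadratic gap then identifies whichever minimiser is chosen with the one constructed.
  The form of \<open>F\<close> is assumed on probability measures only, because merging the past
  losses needs them measurable for \<nu>.\<close>

lemma arg_min_chi2_strong_minimiser:
  fixes g :: "'a \<Rightarrow> real" and F :: "'a measure \<Rightarrow> ereal"
  assumes g: "square_integrable M g" "\<And>x. x \<in> space M \<Longrightarrow> 0 \<le> g x" and "0 < \<eta>"
    and F: "\<And>\<nu>. \<nu> \<in> space (prob_algebra M) \<Longrightarrow>
      F \<nu> = expect \<nu> g + chi2_divergence \<nu> M / ereal \<eta>"
  defines "\<rho> \<equiv> arg_min F (\<lambda>\<nu>. \<nu> \<in> space (prob_algebra M))"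
  obtains p where "square_integrable_density M p" "\<rho> = density M (\<lambda>x. ennreal (p x))"
    "\<And>q. square_integrable_density M q \<Longrightarrow>
      (\<integral>x. p x * g x \<partial>M) + ((\<integral>x. (p x)\<^sup>2 \<partial>M) - 1) / \<eta> + (\<integral>x. (q x - p x)\<^sup>2 \<partial>M) / \<eta>
      \<le> (\<integral>x. q x * g x \<partial>M) + ((\<integral>x. (q x)\<^sup>2 \<partial>M) - 1) / \<eta>"
proof -
  obtain p where p: "square_integrable_density M p"
    and min: "\<And>q. square_integrable_density M q \<Longrightarrow>
      (\<integral>x. p x * g x \<partial>M) + ((\<integral>x. (p x)\<^sup>2 \<partial>M) - 1) / \<eta> + (\<integral>x. (q x - p x)\<^sup>2 \<partial>M) / \<eta>
      \<le> (\<integral>x. q x * g x \<partial>M) + ((\<integral>x. (q x)\<^sup>2 \<partial>M) - 1) / \<eta>"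
    by (rule exists_strong_minimiser[OF g \<open>0 < \<eta>\<close>]) (assumption | rule that)+
  let ?P = "density M (\<lambda>x. ennreal (p x))"
  have F_density: "F (density M (\<lambda>x. ennreal (q x)))
      = ereal ((\<integral>x. q x * g x \<partial>M) + ((\<integral>x. (q x)\<^sup>2 \<partial>M) - 1) / \<eta>)"
    if "square_integrable_density M q" for q
    using F[OF density_in_prob_algebra[OF that]] expect_plus_chi2_density[OF that g] \<open>0 < \<eta>\<close>
    by simp
  \<comment> \<open>Expectations are never negative, so an infinite divergence cannot be
    compensated.\<close>
  have F_density_if_finite: "\<exists>q. square_integrable_density M q \<and> \<nu> = density M (\<lambda>x. ennreal (q x))"
    if "\<nu> \<in> space (prob_algebra M)" "F \<nu> \<noteq> \<infinity>" for \<nu>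
  proof -
    have "chi2_divergence \<nu> M \<noteq> \<infinity>"
      using that F \<open>0 < \<eta>\<close> by (auto simp: expect_def)
    then show ?thesis
      using density_of_finite_chi2_divergence[OF that(1)] by metis
  qed
  have P_le: "F ?P \<le> F \<nu>" if \<nu>: "\<nu> \<in> space (prob_algebra M)" for \<nu>
  proof (cases "F \<nu> = \<infinity>")
    case False
    then obtain q where q: "square_integrable_density M q" "\<nu> = density M (\<lambda>x. ennreal (q x))"
      using F_density_if_finite \<nu> by blast
    moreover have "0 \<le> (\<integral>x. (q x - p x)\<^sup>2 \<partial>M) / \<eta>"
      using \<open>0 < \<eta>\<close> by simp
    ultimately show ?thesis
      using min[OF q(1)] by (simp add: F_density p)
  qed simp
  have "is_arg_min F (\<lambda>\<nu>. \<nu> \<in> space (prob_algebra M)) ?P"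
    using P_le density_in_prob_algebra[OF p] by (simp add: is_arg_min_linorder)
  then have "is_arg_min F (\<lambda>\<nu>. \<nu> \<in> space (prob_algebra M)) \<rho>"
    unfolding \<rho>_def arg_min_def by (rule someI)
  then have \<rho>: "\<rho> \<in> space (prob_algebra M)" "F \<rho> \<le> F ?P"
    using density_in_prob_algebra[OF p] by (auto simp: is_arg_min_linorder)
  moreover have "F \<rho> \<noteq> \<infinity>"
    using \<rho>(2) F_density[OF p] by auto
  ultimately obtain q where q: "square_integrable_density M q" "\<rho> = density M (\<lambda>x. ennreal (q x))"
    using F_density_if_finite by blast
  \<comment> \<open>Since \<open>F \<rho> \<le> F ?P\<close>, the gap between them leaves no room
    for a positive squared distance; hence \<open>q = p\<close> almost everywhere.\<close>
  then have "(\<integral>x. (q x - p x)\<^sup>2 \<partial>M) / \<eta> \<le> 0"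
    using min[OF q(1)] \<rho>(2) by (simp add: F_density p)
  then have "(\<integral>x. (q x - p x)\<^sup>2 \<partial>M) \<le> 0"
    using \<open>0 < \<eta>\<close> by (simp add: divide_le_0_iff)
  moreover have "0 \<le> (\<integral>x. (q x - p x)\<^sup>2 \<partial>M)" by simp
  moreover have "square_integrable M (\<lambda>x. q x - p x)"
    using p q(1) square_integrable_diff by (auto simp: square_integrable_density_def)
  ultimately have "AE x in M. (q x - p x)\<^sup>2 = 0"
    by (subst integral_nonneg_eq_0_iff_AE[symmetric]) (auto simp: square_integrable_def)
  then have "AE x in M. ennreal (q x) = ennreal (p x)"
    by eventually_elim simp
  then have "\<rho> = ?P"
    unfolding q(2) using p q(1)
    by (intro density_cong) (auto simp: square_integrable_density_def square_integrable_def)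
  then show thesis using that p min by blast
qed

section \<open>One round, and the sum over all rounds\<close>

text \<open>The gap \<open>(q - p)\<^sup>2 / \<eta>\<close> pays for the change of the new loss
  between \<open>p\<close> and \<open>q\<close>, up to \<open>\<eta> / 4\<close> times the second
  moment of \<open>f\<close>. The comparator \<nu> is arbitrary, so no minimiser of the next
  objective has to be named.\<close>

lemma ftrl_step:
  fixes g f :: "'a \<Rightarrow> real" and F :: "'a measure \<Rightarrow> ereal"
  assumes g: "square_integrable M g" "\<And>x. x \<in> space M \<Longrightarrow> 0 \<le> g x" and "0 < \<eta>"
    and F: "\<And>\<nu>. \<nu> \<in> space (prob_algebra M) \<Longrightarrow>
      F \<nu> = expect \<nu> g + chi2_divergence \<nu> M / ereal \<eta>"
    and f: "square_integrable M f" "\<And>x. x \<in> space M \<Longrightarrow> 0 \<le> f x"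
    and L: "(\<integral>x. (f x)\<^sup>2 \<partial>M) \<le> L\<^sup>2"
    and \<nu>: "\<nu> \<in> space (prob_algebra M)"
  defines "\<rho> \<equiv> arg_min F (\<lambda>\<nu>. \<nu> \<in> space (prob_algebra M))"
  shows "\<rho> \<in> space (prob_algebra M)"
    and "F \<rho> + expect \<rho> f \<le> F \<nu> + expect \<nu> f + ereal (\<eta> * L\<^sup>2 / 4)"
proof -
  obtain p where p: "square_integrable_density M p" and \<rho>: "\<rho> = density M (\<lambda>x. ennreal (p x))"
    and min: "\<And>q. square_integrable_density M q \<Longrightarrow>
      (\<integral>x. p x * g x \<partial>M) + ((\<integral>x. (p x)\<^sup>2 \<partial>M) - 1) / \<eta> + (\<integral>x. (q x - p x)\<^sup>2 \<partial>M) / \<eta>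
      \<le> (\<integral>x. q x * g x \<partial>M) + ((\<integral>x. (q x)\<^sup>2 \<partial>M) - 1) / \<eta>"
    by (rule arg_min_chi2_strong_minimiser[OF g \<open>0 < \<eta>\<close> F, folded \<rho>_def]) (assumption | rule that)+
  show "\<rho> \<in> space (prob_algebra M)"
    unfolding \<rho> by (rule density_in_prob_algebra[OF p])
  show "F \<rho> + expect \<rho> f \<le> F \<nu> + expect \<nu> f + ereal (\<eta> * L\<^sup>2 / 4)"
  proof (cases "chi2_divergence \<nu> M = \<infinity>")
    case True
    then show ?thesis using F[OF \<nu>] \<open>0 < \<eta>\<close> by (simp add: expect_def)
  next
    case False
    then obtain q where q: "square_integrable_density M q" and \<nu>_eq: "\<nu> = density M (\<lambda>x. ennreal (q x))"
      using density_of_finite_chi2_divergence \<nu> by metis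
    have sp: "square_integrable M p" "\<And>x. 0 \<le> p x" and sq: "square_integrable M q" "\<And>x. 0 \<le> q x"
      using p q by (auto simp: square_integrable_density_def)
    have F_density: "F (density M (\<lambda>x. ennreal (q x)))
        = ereal ((\<integral>x. q x * g x \<partial>M) + ((\<integral>x. (q x)\<^sup>2 \<partial>M) - 1) / \<eta>)"
      if "square_integrable_density M q" for q
      using F[OF density_in_prob_algebra[OF that]] expect_plus_chi2_density[OF that g] \<open>0 < \<eta>\<close>
      by simp
    have pf: "integrable M (\<lambda>x. p x * f x)" and qf: "integrable M (\<lambda>x. q x * f x)"
      by (rule square_integrable_mult[OF sp(1) f(1)], rule square_integrable_mult[OF sq(1) f(1)])
    have ints: "integrable M (\<lambda>x. (q x - p x)\<^sup>2)" "integrable M (\<lambda>x. (f x)\<^sup>2)"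
      using square_integrable_diff[OF sq(1) sp(1)] f(1) by (auto simp: square_integrable_def)
    \<comment> \<open>Completing the square in \<open>q x - p x\<close>, which dictates the constant
      \<open>\<eta> / 4\<close>.\<close>
    have "0 \<le> (q x - p x)\<^sup>2 / \<eta> + \<eta> / 4 * (f x)\<^sup>2 + (q x * f x - p x * f x)" for x
    proof -
      have "(q x - p x)\<^sup>2 / \<eta> + \<eta> / 4 * (f x)\<^sup>2 + (q x * f x - p x * f x)
          = (q x - p x + \<eta> / 2 * f x)\<^sup>2 / \<eta>"
        using \<open>0 < \<eta>\<close> by (simp add: field_simps power2_eq_square)
      then show ?thesis using \<open>0 < \<eta>\<close> by simp
    qed
    then have "0 \<le> (\<integral>x. (q x - p x)\<^sup>2 / \<eta> + \<eta> / 4 * (f x)\<^sup>2 + (q x * f x - p x * f x) \<partial>M)"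
      by (intro integral_nonneg_AE) auto
    also have "\<dots> = (\<integral>x. (q x - p x)\<^sup>2 \<partial>M) / \<eta> + \<eta> / 4 * (\<integral>x. (f x)\<^sup>2 \<partial>M)
        + ((\<integral>x. q x * f x \<partial>M) - (\<integral>x. p x * f x \<partial>M))"
      using pf qf ints by simp
    also have "\<eta> / 4 * (\<integral>x. (f x)\<^sup>2 \<partial>M) \<le> \<eta> / 4 * L\<^sup>2"
      using L \<open>0 < \<eta>\<close> by (intro mult_left_mono) auto
    finally show ?thesis
      using min[OF q] sp sq f
      by (simp add: \<rho> \<nu>_eq F_density p q expect_density)
  qed
qed

end

text \<open>Induction on \<open>T\<close> with \<nu> left general: the induction hypothesis is used
  at the point played in the next round, and \<open>ftrl_step\<close> then passes from that point to
  an arbitrary comparator. The index is shifted: \<open>F (Suc T)\<close> contains the losses of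
  rounds 1 to \<open>T\<close>.\<close>

lemma ftrl_chi2_regret:
  fixes l :: "nat \<Rightarrow> 'a \<Rightarrow> real" and F :: "nat \<Rightarrow> 'a measure \<Rightarrow> ereal"
  assumes \<pi>: "prob_space \<pi>" and "0 < \<eta>"
    and l: "\<And>t. t \<ge> 1 \<Longrightarrow> square_integrable \<pi> (l t)"
      "\<And>t x. t \<ge> 1 \<Longrightarrow> x \<in> space \<pi> \<Longrightarrow> 0 \<le> l t x"
    and L: "\<And>t. t \<ge> 1 \<Longrightarrow> (\<integral>x. (l t x)\<^sup>2 \<partial>\<pi>) \<le> L\<^sup>2"
    and F: "\<And>t \<nu>. F t \<nu> = (\<Sum>s = 1..t - 1. expect \<nu> (l s)) + chi2_divergence \<nu> \<pi> / ereal \<eta>"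
    and \<rho>: "\<And>t. t \<ge> 1 \<Longrightarrow> \<rho> t = arg_min (F t) (\<lambda>\<nu>. \<nu> \<in> space (prob_algebra \<pi>))"
    and \<nu>: "\<nu> \<in> space (prob_algebra \<pi>)"
  shows "(\<Sum>t = 1..T. expect (\<rho> t) (l t)) \<le> F (Suc T) \<nu> + ereal (\<eta> * L\<^sup>2 / 4 * real T)"
  using \<nu>
proof (induction T arbitrary: \<nu>)
  \<comment> \<open>Without losses, the objective is the divergence over \<eta>, which is
    nonnegative.\<close>
  case 0
  then show ?case
    using prob_space.chi2_divergence_nonneg[OF \<pi>] \<open>0 < \<eta>\<close> by (simp add: F)
next
  case (Suc T)
  interpret prob_space \<pi> by (rule \<pi>)
  define g where "g = (\<lambda>x. \<Sum>s = 1..T. l s x)"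
  have F_eq: "F (Suc T) \<mu> = expect \<mu> g + chi2_divergence \<mu> \<pi> / ereal \<eta>"
    if "\<mu> \<in> space (prob_algebra \<pi>)" for \<mu>
  proof -
    have "sets \<mu> = sets \<pi>" using that by (simp add: space_prob_algebra)
    then have "(\<Sum>s = 1..T. expect \<mu> (l s)) = expect \<mu> g"
      unfolding g_def using l sets_eq_imp_space_eq[of \<mu> \<pi>]
      by (intro sum_expect) (auto simp: square_integrable_def cong: measurable_cong_sets)
    then show ?thesis by (simp add: F)
  qed
  have g: "square_integrable \<pi> g" "\<And>x. x \<in> space \<pi> \<Longrightarrow> 0 \<le> g x"
    unfolding g_def using l by (auto intro!: square_integrable_sum sum_nonneg)
  have \<rho>_Suc: "\<rho> (Suc T) = arg_min (F (Suc T)) (\<lambda>\<nu>. \<nu> \<in> space (prob_algebra \<pi>))"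
    by (rule \<rho>) simp
  have step: "\<rho> (Suc T) \<in> space (prob_algebra \<pi>)"
    "F (Suc T) (\<rho> (Suc T)) + expect (\<rho> (Suc T)) (l (Suc T))
      \<le> F (Suc T) \<nu> + expect \<nu> (l (Suc T)) + ereal (\<eta> * L\<^sup>2 / 4)"
    unfolding \<rho>_Suc
    using ftrl_step[OF g \<open>0 < \<eta>\<close> F_eq l L Suc.prems] by auto
  have "(\<Sum>t = 1..Suc T. expect (\<rho> t) (l t))
      = (\<Sum>t = 1..T. expect (\<rho> t) (l t)) + expect (\<rho> (Suc T)) (l (Suc T))"
    by simp
  \<comment> \<open>The induction hypothesis with \<open>\<rho> (Suc T)\<close> as
    comparator.\<close>
  also have "\<dots> \<le> F (Suc T) (\<rho> (Suc T)) + ereal (\<eta> * L\<^sup>2 / 4 * real T) + expect (\<rho> (Suc T)) (l (Suc T))"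
    by (intro add_right_mono Suc.IH step(1))
  also have "\<dots> = (F (Suc T) (\<rho> (Suc T)) + expect (\<rho> (Suc T)) (l (Suc T))) + ereal (\<eta> * L\<^sup>2 / 4 * real T)"
    by (simp add: ac_simps)
  also have "\<dots> \<le> (F (Suc T) \<nu> + expect \<nu> (l (Suc T)) + ereal (\<eta> * L\<^sup>2 / 4)) + ereal (\<eta> * L\<^sup>2 / 4 * real T)"
    by (intro add_right_mono step(2))
  also have "\<dots> = (F (Suc T) \<nu> + expect \<nu> (l (Suc T))) + ereal (\<eta> * L\<^sup>2 / 4 * real (Suc T))"
    by (simp add: add.assoc algebra_simps add_divide_distrib)
  \<comment> \<open>Adding the newest loss turns one objective into the next, which makes the rounds
    telescope.\<close>
  also have "F (Suc T) \<nu> + expect \<nu> (l (Suc T)) = F (Suc (Suc T)) \<nu>"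
    by (simp add: F ac_simps)
  finally show ?case .
qed

theorem corollary2p4:
  fixes M \<pi> :: "'a measure"
    and \<eta> L :: real
    and l :: "nat \<Rightarrow> 'a \<Rightarrow> real"
    and \<rho> :: "nat \<Rightarrow> 'a measure"
    and T :: nat
  assumes "\<pi> \<in> space (prob_algebra M)"
    and "\<eta> > 0"
    and "\<And>t. t \<ge> 1 \<Longrightarrow> l t \<in> borel_measurable M"
    and "\<And>t \<theta>. t \<ge> 1 \<Longrightarrow> \<theta> \<in> space M \<Longrightarrow> l t \<theta> \<ge> 0"
    and "\<And>t. t \<ge> 1 \<Longrightarrow>
      \<rho> t = arg_min
        (\<lambda>\<nu>. (\<Sum>s = 1..t - 1. expect \<nu> (l s)) + chi2_divergence \<nu> \<pi> / ereal \<eta>)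
        (\<lambda>\<nu>. \<nu> \<in> space (prob_algebra M))"
    and "L > 0"
    and "\<And>t. t \<ge> 1 \<Longrightarrow> (\<integral>\<^sup>+ \<theta>. ennreal ((l t \<theta>)\<^sup>2) \<partial>\<pi>) \<le> ennreal (L\<^sup>2)"
    and "T \<ge> 1"
  shows "(\<Sum>t = 1..T. expect (\<rho> t) (l t))
    \<le> (INF \<nu>\<in>space (prob_algebra M).
          (\<Sum>t = 1..T. expect \<nu> (l t)) + ereal (\<eta> * L\<^sup>2 * real T / 2)
            + chi2_divergence \<nu> \<pi> / ereal \<eta>)"
proof (rule INF_greatest)
  fix \<nu> assume "\<nu> \<in> space (prob_algebra M)"
  have \<pi>: "prob_space \<pi>" and sets: "sets \<pi> = sets M"
    using assms(1) by (auto simp: space_prob_algebra)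
  \<comment> \<open>\<open>prob_algebra\<close> depends only on the sigma-algebra, so \<pi> can
    serve as the base space from here on.\<close>
  have pa: "space (prob_algebra M) = space (prob_algebra \<pi>)"
    using sets by (simp add: space_prob_algebra)
  have sq: "square_integrable \<pi> (l t)" "(\<integral>x. (l t x)\<^sup>2 \<partial>\<pi>) \<le> L\<^sup>2" if "t \<ge> 1" for t
    using square_integrable_if_nn_integral_le[OF _ assms(7)[OF that]] assms(3)[OF that] sets
    by (auto cong: measurable_cong_sets)
  define F where "F = (\<lambda>t \<nu>. (\<Sum>s = 1..t - 1. expect \<nu> (l s)) + chi2_divergence \<nu> \<pi> / ereal \<eta>)"
  have "(\<Sum>t = 1..T. expect (\<rho> t) (l t)) \<le> F (Suc T) \<nu> + ereal (\<eta> * L\<^sup>2 / 4 * real T)"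
  proof (rule ftrl_chi2_regret[OF \<pi> \<open>\<eta> > 0\<close> sq(1) _ sq(2)])
    show "\<rho> t = arg_min (F t) (\<lambda>\<nu>. \<nu> \<in> space (prob_algebra \<pi>))" if "t \<ge> 1" for t
      using assms(5)[OF that] by (simp add: F_def pa)
    show "0 \<le> l t x" if "t \<ge> 1" "x \<in> space \<pi>" for t x
      using assms(4) that sets_eq_imp_space_eq[OF sets] by auto
    show "\<nu> \<in> space (prob_algebra \<pi>)"
      using \<open>\<nu> \<in> space (prob_algebra M)\<close> by (simp add: pa)
  qed (simp_all add: F_def)
  \<comment> \<open>The argument yields \<open>\<eta> * L\<^sup>2 / 4\<close> per round, half of
    what is claimed; the surplus is given away here.\<close>
  also have "\<dots> \<le> F (Suc T) \<nu> + ereal (\<eta> * L\<^sup>2 * real T / 2)"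
    using \<open>\<eta> > 0\<close> by (intro add_left_mono) (simp add: field_simps)
  also have "\<dots> = (\<Sum>t = 1..T. expect \<nu> (l t)) + ereal (\<eta> * L\<^sup>2 * real T / 2)
      + chi2_divergence \<nu> \<pi> / ereal \<eta>"
    by (simp add: F_def ac_simps)
  finally show "(\<Sum>t = 1..T. expect (\<rho> t) (l t)) \<le> (\<Sum>t = 1..T. expect \<nu> (l t))
      + ereal (\<eta> * L\<^sup>2 * real T / 2) + chi2_divergence \<nu> \<pi> / ereal \<eta>" .
qed

end
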